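(* Let $X$, $Z$ be non-trivial real locally convex topological linear spaces, $C\subseteq Z$ a convex cone with $0\in C\neq Z$, and let $f \colon X \to \mathcal P(Z, C)$ be a function. Then $f = f^{**}$ if, and only if, $f$ is proper, closed and convex, or identically $Z$, or identically $\emptyset$.
   Context: A set $C$ is a cone if $z\in C$, $t>0$ imply $tz\in C$. $\mathcal P(Z,C) = \{A\subseteq Z\mid A = A+C\}$ (Minkowski addition, $\emptyset+C=\emptyset$, so $\emptyset,Z\in\mathcal P(Z,C)$). $X^*$, $Z^*$ are the topological duals and $C^+ = \{z^* \in Z^* \mid \forall z \in C\colon z^*(z)\ge 0\}$. Inf-residuation: $A\ominus B = \{z\in Z\mid B+z\subseteq A\}$ (so $A\ominus\emptyset=Z$). For $x^*\in X^*$, $z^*\in Z^*$, $x\in X$: $S_{(x^*,z^* )}(x) = \{z\in Z\mid x^*(x)\le z^*(z)\}$. $f$ is convex (closed) if $\operatorname{graph} f = \{(x,z)\in X\times Z\mid z\in f(x)\}$ is convex (closed in the product topology); $f$ is proper if $f(x)\ne\emptyset$ for some $x\in X$ and $f(x)\neq Z$ for all $x\in X$. Fenchel conjugate: $f^*\colon X^*\times (C^+\setminus\{0\})\to\mathcal P(Z,C)$, $f^*(x^*,z^* ) = \bigcap_{x\in X}\big(S_{(x^*,z^* )}(x)\ominus f(x)\big)$. Biconjugate: $f^{**}\colon X\to\mathcal P(Z,C)$, $f^{**}(x) = \bigcap_{x^*\in X^*,\,z^*\in C^+\setminus\{0\}}\big(S_{(x^*,z^* )}(x)\ominus f^*(x^*,z^*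 )\big)$.
   Formalization: When f is identically ∅, it is additionally assumed that C⁺ ≠ {0}; otherwise (e.g. C a dense half-space of a discontinuous linear functional) the intersection defining f** is empty, so f** is identically Z and the stated equivalence fails. *)

theory Defs
  imports "HOL-Analysis.Analysis"
begin

text \<open>
  Real locally convex topological linear spaces, not necessarily Hausdorff. Continuity of negation,
  required by \<open>topological_ab_group_add\<close>, also follows from that of scalar multiplication.
  The last clause is \<^const>\<open>convex\<close> unfolded, which cannot be applied to the type being axiomatised.
\<close>

class locally_convex_space = real_vector + topological_ab_group_add +
  assumes tendsto_scaleR_Pair:
    "filterlim (\<lambda>p. fst p *\<^sub>R snd p) (nhds (t *\<^sub>R x)) (nhds t \<times>\<^sub>F nhds x)"
  and convex_open_base_0:
    "open U \<Longrightarrow> 0 \<in> U \<Longrightarrow> \<exists>V. open V \<and> 0 \<in> V \<and> V \<subseteq> U \<and>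
       (\<forall>x\<in>V. \<forall>y\<in>V. \<forall>u\<ge>0. \<forall>v\<ge>0. u + v = 1 \<longrightarrow> u *\<^sub>R x + v *\<^sub>R y \<in> V)"

definition topological_dual :: "('a::locally_convex_space \<Rightarrow> real) set" where
  "topological_dual = {\<phi>. linear \<phi> \<and> continuous_on UNIV \<phi>}"

text \<open>
  Unlike the library's \<^const>\<open>cone\<close>, closure is required under strictly positive scalars only, so
  \<open>0\<close> need not be an element.
\<close>

definition pos_cone :: "'a::real_vector set \<Rightarrow> bool" where
  "pos_cone C \<longleftrightarrow> (\<forall>z\<in>C. \<forall>t>0. t *\<^sub>R z \<in> C)"

definition dual_cone :: "'z::locally_convex_space set \<Rightarrow> ('z \<Rightarrow> real) set" where
  "dual_cone C = {\<zeta> \<in> topological_dual. \<forall>z\<in>C. \<zeta> z \<ge> 0}"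

text \<open>The sets \<open>\<P>(Z, C)\<close>; the sum is the Minkowski sum of sets.\<close>

definition upper_sets :: "'z::ab_group_add set \<Rightarrow> 'z set set" where
  "upper_sets C = {A. A = A + C}"

definition inf_residual :: "'z::ab_group_add set \<Rightarrow> 'z set \<Rightarrow> 'z set" (infixl "\<ominus>\<^sub>r" 65) where
  "A \<ominus>\<^sub>r B = {z. (\<lambda>b. b + z) ` B \<subseteq> A}"

definition S_fun :: "('x \<Rightarrow> real) \<Rightarrow> ('z \<Rightarrow> real) \<Rightarrow> 'x \<Rightarrow> 'z set" where
  "S_fun \<xi> \<zeta> x = {z. \<xi> x \<le> \<zeta> z}"

definition graph_of :: "('x \<Rightarrow> 'z set) \<Rightarrow> ('x \<times> 'z) set" where
  "graph_of f = {(x, z). z \<in> f x}"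

definition convex_fun :: "('x::real_vector \<Rightarrow> 'z::real_vector set) \<Rightarrow> bool" where
  "convex_fun f \<longleftrightarrow> convex (graph_of f)"

definition closed_fun :: "('x::topological_space \<Rightarrow> 'z::topological_space set) \<Rightarrow> bool" where
  "closed_fun f \<longleftrightarrow> closed (graph_of f)"

definition proper_fun :: "('x \<Rightarrow> 'z set) \<Rightarrow> bool" where
  "proper_fun f \<longleftrightarrow> (\<exists>x. f x \<noteq> {}) \<and> (\<forall>x. f x \<noteq> UNIV)"

text \<open>
  The conjugate is only meaningful, and only used below, for \<open>\<xi>\<close> in the topological dual and
  \<open>\<zeta> \<in> dual_cone C - {0}\<close>.
\<close>

definition conjugate ::
  "('x \<Rightarrow> 'z::ab_group_add set) \<Rightarrow> ('x \<Rightarrow> real) \<Rightarrow> ('z \<Rightarrow> real) \<Rightarrow> 'z set" where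
  "conjugate f \<xi> \<zeta> = (\<Inter>x. S_fun \<xi> \<zeta> x \<ominus>\<^sub>r f x)"

text \<open>
  If \<open>dual_cone C = {0}\<close>, which happens for dense \<open>C\<close>, the intersection is empty and the biconjugate
  is identically the whole space; the identically empty function then differs from its biconjugate.
\<close>

definition biconjugate ::
  "'z::locally_convex_space set \<Rightarrow> ('x::locally_convex_space \<Rightarrow> 'z set) \<Rightarrow> 'x \<Rightarrow> 'z set" where
  "biconjugate C f x =
     (\<Inter>\<xi>\<in>topological_dual. \<Inter>\<zeta>\<in>dual_cone C - {\<lambda>_. 0}. S_fun \<xi> \<zeta> x \<ominus>\<^sub>r conjugate f \<xi> \<zeta>)"

end

theory Submission
  imports Defs
begin

text \<open>
  By the Hahn-Banach separation theorem on \<open>X \<times> Z\<close>, the biconjugate of a closed convex function \<open>f\<close>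
  with nonempty graph can only differ from \<open>f\<close> because halfspaces with a vertical normal
  \<open>(\<xi>, 0)\<close> are not admitted. If \<open>f\<close> is proper, then some point over the effective domain of \<open>f\<close> lies
  outside the graph, and the functional separating it is not vertical; adding to it a large multiple
  of a vertical separating functional makes the latter admissible. Conversely, if \<open>f x = UNIV\<close> for
  one \<open>x\<close>, then no nonvertical functional is bounded above on the graph, so the biconjugate is
  identically \<open>UNIV\<close>.
\<close>

subsection \<open>Sublinear functionals\<close>

definition sublinear :: "('a::real_vector \<Rightarrow> real) \<Rightarrow> bool" where
  "sublinear p \<longleftrightarrow> (\<forall>x y. p (x + y) \<le> p x + p y) \<and> (\<forall>t\<ge>0. \<forall>x. p (t *\<^sub>R x) = t * p x)"

lemma sublinear_add: "sublinear p \<Longrightarrow> p (x + y) \<le> p x + p y"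
  and sublinear_scale: "sublinear p \<Longrightarrow> 0 \<le> t \<Longrightarrow> p (t *\<^sub>R x) = t * p x"
  by (auto simp: sublinear_def)

lemma sublinear_0: "sublinear p \<Longrightarrow> p 0 = 0"
  using sublinear_scale[of p 0 0] by simp

lemma sublinear_uminus: "sublinear p \<Longrightarrow> - p (- x) \<le> p x"
  using sublinear_add[of p x "- x"] by (simp add: sublinear_0)

text \<open>Applying the one-sided scaling bound to the inverse scalar turns it into an equality.
  The value at \<open>0\<close> then vanishes because \<open>p 0 = 2 * p 0\<close>.\<close>

lemma sublinearI:
  assumes add: "\<And>x y. p (x + y) \<le> p x + p y"
    and scale: "\<And>t x. 0 < t \<Longrightarrow> p (t *\<^sub>R x) \<le> t * p x"
  shows "sublinear p"
proof -
  have pos: "p (t *\<^sub>R x) = t * p x" if "0 < t" for t x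
  proof (rule antisym)
    have "p x \<le> inverse t * p (t *\<^sub>R x)"
      using scale[of "inverse t" "t *\<^sub>R x"] that by simp
    then show "t * p x \<le> p (t *\<^sub>R x)"
      using that by (simp add: field_simps)
  qed (use scale that in auto)
  have "p 0 = 0"
    using pos[of 2 0] by simp
  then show ?thesis
    using add pos by (auto simp: sublinear_def order_le_less)
qed

text \<open>For sublinear \<open>p\<close> this is the largest sublinear functional below
  \<open>p\<close> whose value at \<open>- a\<close> is at most \<open>- p a\<close>. Hence a linear
  functional below it agrees with \<open>p\<close> at \<open>a\<close>.\<close>

definition tilt :: "('a::real_vector \<Rightarrow> real) \<Rightarrow> 'a \<Rightarrow> 'a \<Rightarrow> real" where
  "tilt p a x = (INF t\<in>{0..}. p (x + t *\<^sub>R a) - t * p a)"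

lemma tilt_le:
  assumes "sublinear p" "0 \<le> t"
  shows "tilt p a x \<le> p (x + t *\<^sub>R a) - t * p a"
  unfolding tilt_def
proof (rule cINF_lower)
  \<comment> \<open>Finiteness of the infimum: splitting \<open>t a\<close> as
    \<open>(x + t a) + (- x)\<close> gives the lower bound \<open>- p (- x)\<close>, uniform in
    \<open>t\<close>.\<close>
  show "bdd_below ((\<lambda>t. p (x + t *\<^sub>R a) - t * p a) ` {0..})"
  proof (rule bdd_belowI2)
    fix s :: real assume "s \<in> {0..}"
    then show "- p (- x) \<le> p (x + s *\<^sub>R a) - s * p a"
      using sublinear_add[OF assms(1), of "x + s *\<^sub>R a" "- x"] sublinear_scale[OF assms(1), of s a]
      by simp
  qed
qed (use assms in auto)

lemma tilt_greatest: "(\<And>t. 0 \<le> t \<Longrightarrow> c \<le> p (x + t *\<^sub>R a) - t * p a) \<Longrightarrow> c \<le> tilt p a x"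
  unfolding tilt_def by (rule cINF_greatest) auto

lemma sublinear_tilt:
  assumes p: "sublinear p"
  shows "sublinear (tilt p a)"
proof (rule sublinearI)
  fix x y
  \<comment> \<open>The two infima on the right are handled one after the other; the parameters
    \<open>s\<close> for \<open>x\<close> and \<open>t\<close> for \<open>y\<close> combine to
    \<open>s + t\<close> for \<open>x + y\<close>.\<close>
  have "tilt p a (x + y) - tilt p a y \<le> tilt p a x"
  proof (rule tilt_greatest)
    fix s :: real assume s: "0 \<le> s"
    have "tilt p a (x + y) - (p (x + s *\<^sub>R a) - s * p a) \<le> tilt p a y"
    proof (rule tilt_greatest)
      fix t :: real assume t: "0 \<le> t"
      have "tilt p a (x + y) \<le> p ((x + y) + (s + t) *\<^sub>R a) - (s + t) * p a"
        using s t by (intro tilt_le p) auto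
      also have "(x + y) + (s + t) *\<^sub>R a = (x + s *\<^sub>R a) + (y + t *\<^sub>R a)"
        by (simp add: algebra_simps)
      also have "p \<dots> \<le> p (x + s *\<^sub>R a) + p (y + t *\<^sub>R a)"
        by (rule sublinear_add[OF p])
      finally show "tilt p a (x + y) - (p (x + s *\<^sub>R a) - s * p a) \<le> p (y + t *\<^sub>R a) - t * p a"
        by (simp add: algebra_simps)
    qed
    then show "tilt p a (x + y) - tilt p a y \<le> p (x + s *\<^sub>R a) - s * p a"
      by simp
  qed
  then show "tilt p a (x + y) \<le> tilt p a x + tilt p a y"
    by simp
next
  fix k :: real and x
  assume k: "0 < k"
  have "tilt p a (k *\<^sub>R x) / k \<le> tilt p a x"
  proof (rule tilt_greatest)
    fix t :: real assume t: "0 \<le> t"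
    \<comment> \<open>The parameter \<open>t\<close> at \<open>x\<close> corresponds to
      \<open>k * t\<close> at the rescaled point, so \<open>k\<close> factors out of
      \<open>p\<close>.\<close>
    have "tilt p a (k *\<^sub>R x) \<le> p (k *\<^sub>R x + (k * t) *\<^sub>R a) - (k * t) * p a"
      using k t by (intro tilt_le p) auto
    also have "p (k *\<^sub>R x + (k * t) *\<^sub>R a) = k * p (x + t *\<^sub>R a)"
      using sublinear_scale[OF p, of k "x + t *\<^sub>R a"] k by (simp add: scaleR_add_right)
    finally show "tilt p a (k *\<^sub>R x) / k \<le> p (x + t *\<^sub>R a) - t * p a"
      using k by (simp add: field_simps)
  qed
  then show "tilt p a (k *\<^sub>R x) \<le> k * tilt p a x"
    using k by (simp add: field_simps)
qed

text \<open>
  The tilt of a minimal sublinear functional is the functional itself, which gives additivity.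
  This replaces the usual extension of functionals from subspaces.
\<close>

lemma minimal_sublinear_linear:
  assumes q: "sublinear q" and min: "\<And>r. sublinear r \<Longrightarrow> r \<le> q \<Longrightarrow> r = q"
  shows "linear q"
proof -
  have add: "q (x + a) = q x + q a" for x a
  proof (rule antisym)
    have "tilt q a \<le> q"
      using tilt_le[OF q, of 0 a] by (auto simp: le_fun_def)
    then have "tilt q a = q"
      by (intro min sublinear_tilt q)
    then show "q x + q a \<le> q (x + a)"
      \<comment> \<open>Parameter 0 gave \<open>tilt q a \<le> q\<close>; parameter 1 now gives
        \<open>q x \<le> q (x + a) - q a\<close>, the reverse of subadditivity.\<close>
      using tilt_le[OF q, of 1 a x] by simp
  qed (rule sublinear_add[OF q])
  have neg: "q (- x) = - q x" for x
    using add[of x "- x"] sublinear_0[OF q] by simp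
  have "q (t *\<^sub>R x) = t * q x" for t x
  proof (cases "0 \<le> t")
    case False
    then have "q (- (t *\<^sub>R x)) = - t * q x"
      using sublinear_scale[OF q, of "- t" x] by simp
    then show ?thesis
      using neg[of "t *\<^sub>R x"] by simp
  qed (rule sublinear_scale[OF q])
  then show ?thesis
    by (intro linearI) (auto simp: add)
qed

section \<open>The Hahn-Banach theorem by Zorn's lemma\<close>

lemma sublinear_INF_chain:
  fixes Q :: "('a::real_vector \<Rightarrow> real) set"
  assumes ne: "Q \<noteq> {}" and sub: "\<And>q. q \<in> Q \<Longrightarrow> sublinear q \<and> q \<le> p"
    and chain: "\<And>q r. q \<in> Q \<Longrightarrow> r \<in> Q \<Longrightarrow> q \<le> r \<or> r \<le> q"
  shows "sublinear (\<lambda>x. INF q\<in>Q. q x)" "\<And>q x. q \<in> Q \<Longrightarrow> (INF q\<in>Q. q x) \<le> q x"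
proof -
  have bdd: "bdd_below ((\<lambda>q. q x) ` Q)" for x
  proof (rule bdd_belowI2)
    fix q assume "q \<in> Q"
    \<comment> \<open>The chain \<open>- p (- x) \<le> - q (- x) \<le> q x\<close> gives a bound
      independent of \<open>q\<close>.\<close>
    then show "- p (- x) \<le> q x"
      using sub[of q] sublinear_uminus[of q x] le_funD[of q p "- x"] by simp
  qed
  show lower: "(INF q\<in>Q. q x) \<le> q x" if "q \<in> Q" for q x
    by (rule cINF_lower[OF bdd that])
  show "sublinear (\<lambda>x. INF q\<in>Q. q x)"
  proof (rule sublinearI)
    fix x y
    \<comment> \<open>The smaller functional \<open>m\<close> of \<open>q\<close> and
      \<open>r\<close> satisfies \<open>m (x + y) \<le> m x + m y \<le> q x + r y\<close>. This lets
      the infima at \<open>x\<close> and at \<open>y\<close> be taken independently.\<close>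
    have key: "(INF q\<in>Q. q (x + y)) \<le> q x + r y" if "q \<in> Q" "r \<in> Q" for q r
    proof -
      have "\<exists>m\<in>Q. m \<le> q \<and> m \<le> r"
        using chain[OF that] that by blast
      then obtain m where m: "m \<in> Q" "m \<le> q" "m \<le> r"
        by blast
      have "(INF q\<in>Q. q (x + y)) \<le> m (x + y)"
        by (rule lower[OF m(1)])
      also have "\<dots> \<le> m x + m y"
        using sub[OF m(1)] by (auto intro: sublinear_add)
      finally show ?thesis
        using add_mono[OF le_funD[OF m(2), of x] le_funD[OF m(3), of y]] by simp
    qed
    have "(INF q\<in>Q. q (x + y)) - (INF q\<in>Q. q y) \<le> (INF q\<in>Q. q x)"
    proof (rule cINF_greatest[OF ne])
      fix q assume q: "q \<in> Q"
      have "(INF q\<in>Q. q (x + y)) - q x \<le> (INF q\<in>Q. q y)"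
        by (rule cINF_greatest[OF ne]) (use key[OF q] in \<open>simp add: diff_le_eq add.commute\<close>)
      then show "(INF q\<in>Q. q (x + y)) - (INF q\<in>Q. q y) \<le> q x"
        by simp
    qed
    then show "(INF q\<in>Q. q (x + y)) \<le> (INF q\<in>Q. q x) + (INF q\<in>Q. q y)"
      by simp
  next
    fix t :: real and x
    assume t: "0 < t"
    have "(INF q\<in>Q. q (t *\<^sub>R x)) / t \<le> (INF q\<in>Q. q x)"
    proof (rule cINF_greatest[OF ne])
      fix q assume q: "q \<in> Q"
      have "(INF q\<in>Q. q (t *\<^sub>R x)) \<le> t * q x"
        using lower[OF q, of "t *\<^sub>R x"] sub[OF q] t by (simp add: sublinear_scale)
      then show "(INF q\<in>Q. q (t *\<^sub>R x)) / t \<le> q x"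
        using t by (simp add: field_simps)
    qed
    then show "(INF q\<in>Q. q (t *\<^sub>R x)) \<le> t * (INF q\<in>Q. q x)"
      using t by (simp add: field_simps)
  qed
qed

text \<open>Zorn's lemma for the reversed order yields a minimal sublinear functional below
  \<open>p\<close>, and minimality forces linearity. Chains are bounded by their pointwise infimum,
  the empty chain by \<open>p\<close>.\<close>

lemma sublinear_above_linear:
  assumes p: "sublinear p"
  obtains \<phi> where "linear \<phi>" "\<phi> \<le> p"
proof -
  let ?A = "{q. sublinear q \<and> q \<le> p}"
  have "\<exists>m\<in>?A. \<forall>a\<in>?A. a \<le> m \<longrightarrow> a = m"
  proof (rule predicate_Zorn)
    show "partial_order_on ?A (relation_of (\<lambda>q r. r \<le> q) ?A)"
      by (auto simp: partial_order_on_def preorder_on_def refl_on_def trans_def antisym_def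
          relation_of_def)
  next
    fix Q assume Q: "Q \<in> Chains (relation_of (\<lambda>q r. r \<le> q) ?A)"
    show "\<exists>u\<in>?A. \<forall>a\<in>Q. u \<le> a"
    proof (cases "Q = {}")
      case True
      then show ?thesis using p by blast
    next
      case False
      have sub: "sublinear q \<and> q \<le> p" if "q \<in> Q" for q
        using Q that by (auto simp: Chains_def relation_of_def)
      have chain: "q \<le> r \<or> r \<le> q" if "q \<in> Q" "r \<in> Q" for q r
        using Q that by (auto simp: Chains_def relation_of_def)
      let ?u = "\<lambda>x. INF q\<in>Q. q x"
      have "sublinear ?u" and le: "\<And>q. q \<in> Q \<Longrightarrow> ?u \<le> q"
        using sublinear_INF_chain[OF False sub chain] by (auto simp: le_fun_def)
      moreover have "?u \<le> p"
        using False le sub by (meson all_not_in_conv order_trans)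
      ultimately show ?thesis by blast
    qed
  qed
  then obtain m where "sublinear m" "m \<le> p"
    and "\<And>a. sublinear a \<Longrightarrow> a \<le> p \<Longrightarrow> a \<le> m \<Longrightarrow> a = m"
    by blast
  then have "linear m"
    by (intro minimal_sublinear_linear) (auto intro: order_trans)
  then show thesis
    using \<open>m \<le> p\<close> by (rule that)
qed

text \<open>A linear functional below \<open>tilt p a\<close> does it: parameter 0 puts it below
  \<open>p\<close>, and parameter 1 at \<open>- a\<close> gives
  \<open>\<phi> (- a) \<le> - p a\<close>, that is \<open>p a \<le> \<phi> a\<close>.\<close>

theorem Hahn_Banach_sublinear:
  assumes p: "sublinear p"
  obtains \<phi> where "linear \<phi>" "\<phi> \<le> p" "\<phi> a = p a"
proof -
  obtain \<phi> where \<phi>: "linear \<phi>" "\<phi> \<le> tilt p a"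
    using sublinear_above_linear[OF sublinear_tilt[OF p]] by blast
  have le: "\<phi> \<le> p"
    using \<phi>(2) tilt_le[OF p, of 0 a] by (auto simp: le_fun_def intro: order_trans)
  have "\<phi> (- a) \<le> - p a"
    using \<phi>(2) tilt_le[OF p, of 1 a "- a"] sublinear_0[OF p]
    by (auto simp: le_fun_def intro: order_trans)
  then have "\<phi> a = p a"
    using le by (simp add: linear_neg[OF \<phi>(1)] le_fun_def antisym)
  with \<phi>(1) le show thesis by (rule that)
qed

section \<open>The Minkowski gauge of an absorbing convex set\<close>

definition minkowski_gauge :: "'a::real_vector set \<Rightarrow> 'a \<Rightarrow> real" where
  "minkowski_gauge K x = Inf {t. 0 < t \<and> inverse t *\<^sub>R x \<in> K}"

context
  fixes K :: "'a::real_vector set"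
  assumes cvx: "convex K" and absorbing: "\<And>x. \<exists>t>0. inverse t *\<^sub>R x \<in> K"
begin

lemma minkowski_gauge_le: "0 < t \<Longrightarrow> inverse t *\<^sub>R x \<in> K \<Longrightarrow> minkowski_gauge K x \<le> t"
  unfolding minkowski_gauge_def by (rule cInf_lower) (auto intro: bdd_belowI[of _ 0])

lemma minkowski_gauge_greatest:
  "(\<And>t. 0 < t \<Longrightarrow> inverse t *\<^sub>R x \<in> K \<Longrightarrow> c \<le> t) \<Longrightarrow> c \<le> minkowski_gauge K x"
  unfolding minkowski_gauge_def by (rule cInf_greatest) (use absorbing in auto)

lemma sublinear_minkowski_gauge: "sublinear (minkowski_gauge K)"
proof (rule sublinearI)
  fix x y
  have key: "minkowski_gauge K (x + y) \<le> s + t"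
    if s: "0 < s" "inverse s *\<^sub>R x \<in> K" and t: "0 < t" "inverse t *\<^sub>R y \<in> K" for s t
  proof (rule minkowski_gauge_le)
    \<comment> \<open>Weighting \<open>x / s\<close> and \<open>y / t\<close> in proportion to
      \<open>s\<close> and \<open>t\<close> cancels the denominators and leaves
      \<open>(x + y) / (s + t)\<close>.\<close>
    have "(s / (s + t)) *\<^sub>R (inverse s *\<^sub>R x) + (t / (s + t)) *\<^sub>R (inverse t *\<^sub>R y) \<in> K"
      using s t by (intro convexD[OF cvx]) (auto simp: add_divide_distrib[symmetric])
    also have "(s / (s + t)) *\<^sub>R (inverse s *\<^sub>R x) + (t / (s + t)) *\<^sub>R (inverse t *\<^sub>R y)
        = inverse (s + t) *\<^sub>R (x + y)"
      using s t by (simp add: scaleR_add_right field_simps)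
    finally show "inverse (s + t) *\<^sub>R (x + y) \<in> K" .
  qed (use s t in simp)
  have "minkowski_gauge K (x + y) - minkowski_gauge K y \<le> minkowski_gauge K x"
  proof (rule minkowski_gauge_greatest)
    fix s assume s: "0 < s" "inverse s *\<^sub>R x \<in> K"
    have "minkowski_gauge K (x + y) - s \<le> minkowski_gauge K y"
      by (rule minkowski_gauge_greatest) (use key[OF s] in \<open>simp add: diff_le_eq add.commute\<close>)
    then show "minkowski_gauge K (x + y) - minkowski_gauge K y \<le> s"
      by simp
  qed
  then show "minkowski_gauge K (x + y) \<le> minkowski_gauge K x + minkowski_gauge K y"
    by simp
next
  fix k :: real and x
  assume k: "0 < k"
  have "minkowski_gauge K (k *\<^sub>R x) / k \<le> minkowski_gauge K x"
  proof (rule minkowski_gauge_greatest)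
    fix t assume t: "0 < t" "inverse t *\<^sub>R x \<in> K"
    have "minkowski_gauge K (k *\<^sub>R x) \<le> k * t"
    proof (rule minkowski_gauge_le)
      have "inverse (k * t) *\<^sub>R (k *\<^sub>R x) = inverse t *\<^sub>R x"
        using k by (simp add: field_simps)
      with t(2) show "inverse (k * t) *\<^sub>R (k *\<^sub>R x) \<in> K"
        by (simp only:)
    qed (use k t in simp)
    then show "minkowski_gauge K (k *\<^sub>R x) / k \<le> t"
      using k by (simp add: field_simps)
  qed
  then show "minkowski_gauge K (k *\<^sub>R x) \<le> k * minkowski_gauge K x"
    using k by (simp add: field_simps)
qed

lemma minkowski_gauge_le_1: "x \<in> K \<Longrightarrow> minkowski_gauge K x \<le> 1"
  by (rule minkowski_gauge_le) auto

lemma minkowski_gauge_ge_1: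
  assumes "x \<notin> K"
  shows "1 \<le> minkowski_gauge K x"
proof (rule minkowski_gauge_greatest)
  fix t assume t: "0 < t" "inverse t *\<^sub>R x \<in> K"
  have "0 \<in> K"
    using absorbing[of 0] by simp
  show "1 \<le> t"
  proof (rule ccontr)
    assume "\<not> 1 \<le> t"
    \<comment> \<open>For \<open>t < 1\<close> the point \<open>x\<close> is itself a convex
      combination of \<open>x / t\<close> and \<open>0\<close>, both in \<open>K\<close>.\<close>
    then have "t *\<^sub>R (inverse t *\<^sub>R x) + (1 - t) *\<^sub>R 0 \<in> K"
      using t \<open>0 \<in> K\<close> by (intro convexD[OF cvx]) auto
    then show False
      using assms t by simp
  qed
qed

end

subsection \<open>Separation in locally convex spaces\<close>

lemma tendsto_scaleR_lcs:
  fixes g :: "'b \<Rightarrow> 'a::locally_convex_space"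
  assumes "(f \<longlongrightarrow> a) F" "(g \<longlongrightarrow> b) F"
  shows "((\<lambda>x. f x *\<^sub>R g x) \<longlongrightarrow> a *\<^sub>R b) F"
  using filterlim_compose[OF tendsto_scaleR_Pair filterlim_Pair[OF assms]] by simp

section \<open>Products of locally convex spaces, so that separation applies to graphs in
  \<open>X \<times> Z\<close>\<close>

instance prod :: (topological_monoid_add, topological_monoid_add) topological_monoid_add
proof
  fix a b :: "'a \<times> 'b"
  have "(fst \<longlongrightarrow> a) (nhds (a, b))" "(snd \<longlongrightarrow> b) (nhds (a, b))"
    using tendsto_fst[OF filterlim_ident, of "(a, b)"] tendsto_snd[OF filterlim_ident, of "(a, b)"]
    by simp_all
  then have "((\<lambda>x. fst x + snd x) \<longlongrightarrow> a + b) (nhds (a, b))"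
    unfolding plus_prod_def by (intro tendsto_intros)
  then show "((\<lambda>x. fst x + snd x) \<longlongrightarrow> a + b) (nhds a \<times>\<^sub>F nhds b)"
    by (simp add: nhds_prod)
qed

instance prod :: (topological_group_add, topological_group_add) topological_group_add
proof
  fix a :: "'a \<times> 'b"
  show "(uminus \<longlongrightarrow> - a) (nhds a)"
    unfolding uminus_prod_def by (intro tendsto_intros filterlim_ident)
qed

instance prod :: (topological_ab_group_add, topological_ab_group_add) topological_ab_group_add ..

lemma convex_open_base_0_lcs:
  fixes U :: "'a::locally_convex_space set"
  assumes "open U" "0 \<in> U"
  obtains V where "open V" "0 \<in> V" "V \<subseteq> U" "convex V"
proof -
  obtain V where "open V" "0 \<in> V" "V \<subseteq> U"
    and "\<forall>x\<in>V. \<forall>y\<in>V. \<forall>u\<ge>0. \<forall>v\<ge>0. u + v = 1 \<longrightarrow> u *\<^sub>R x + v *\<^sub>R y \<in> V"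
    using convex_open_base_0[OF assms] by blast
  then show thesis
    using that by (auto simp: convex_def)
qed

instance prod :: (locally_convex_space, locally_convex_space) locally_convex_space
proof
  fix t :: real and x :: "'a \<times> 'b"
  have "((\<lambda>p. fst p *\<^sub>R snd p) \<longlongrightarrow> t *\<^sub>R x) (nhds (t, x))"
    unfolding scaleR_prod_def
    by (intro tendsto_Pair tendsto_scaleR_lcs tendsto_fst tendsto_snd)
      (auto intro!: tendsto_eq_intros filterlim_ident)
  then show "((\<lambda>p. fst p *\<^sub>R snd p) \<longlongrightarrow> t *\<^sub>R x) (nhds t \<times>\<^sub>F nhds x)"
    by (simp add: nhds_prod)
next
  fix U :: "('a \<times> 'b) set"
  assume "open U" "0 \<in> U"
  then obtain A B where AB: "open A" "open B" "0 \<in> A" "0 \<in> B" "A \<times> B \<subseteq> U"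
    unfolding open_prod_def by (fastforce simp: zero_prod_def)
  obtain V where V: "open V" "0 \<in> V" "V \<subseteq> A" "convex V"
    using convex_open_base_0_lcs[OF AB(1,3)] by blast
  obtain W where W: "open W" "0 \<in> W" "W \<subseteq> B" "convex W"
    using convex_open_base_0_lcs[OF AB(2,4)] by blast
  have "convex (V \<times> W)"
    using V(4) W(4) by (rule convex_Times)
  then show "\<exists>V. open V \<and> 0 \<in> V \<and> V \<subseteq> U \<and>
       (\<forall>x\<in>V. \<forall>y\<in>V. \<forall>u\<ge>0. \<forall>v\<ge>0. u + v = 1 \<longrightarrow> u *\<^sub>R x + v *\<^sub>R y \<in> V)"
    using V W AB by (intro exI[of _ "V \<times> W"]) (auto simp: convex_def open_Times zero_prod_def)
qed

section \<open>Separating a point from a closed convex set\<close>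

lemma open_absorbing:
  fixes U :: "'a::locally_convex_space set"
  assumes "open U" "0 \<in> U"
  obtains t where "0 < t" "inverse t *\<^sub>R x \<in> U"
proof -
  have "((\<lambda>s. s *\<^sub>R x) \<longlongrightarrow> 0 *\<^sub>R x) (at_right (0::real))"
    by (rule tendsto_scaleR_lcs[OF tendsto_ident_at tendsto_const])
  then have "\<forall>\<^sub>F s in at_right (0::real). s *\<^sub>R x \<in> U"
    by (rule topological_tendstoD) (use assms in auto)
  with eventually_at_right_less have "\<forall>\<^sub>F s in at_right (0::real). 0 < s \<and> s *\<^sub>R x \<in> U"
    by (rule eventually_conj)
  from eventually_happens'[OF trivial_limit_at_right_real this]
  obtain s :: real where "0 < s" "s *\<^sub>R x \<in> U"
    by blast
  then show thesis
    by (intro that[of "inverse s"]) simp_all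
qed

text \<open>A one-sided bound suffices: near \<open>a\<close>, scaled copies of both
  \<open>x - a\<close> and \<open>a - x\<close> lie in \<open>U\<close>, which bounds the difference
  of the values from both sides.\<close>

lemma linear_continuous_bounded_above:
  fixes \<phi> :: "'a::locally_convex_space \<Rightarrow> real"
  assumes lin: "linear \<phi>" and U: "open U" "0 \<in> U" and le: "\<And>u. u \<in> U \<Longrightarrow> \<phi> u \<le> 1"
  shows "continuous_on UNIV \<phi>"
  unfolding continuous_on_def
proof
  fix a
  show "(\<phi> \<longlongrightarrow> \<phi> a) (at a)"
  proof (rule tendstoI)
    fix e :: real assume e: "0 < e"
    \<comment> \<open>The factor \<open>2 / e\<close> yields a deviation of at most
      \<open>e / 2\<close>, strictly less than \<open>e\<close>.\<close>
    have "((\<lambda>x. (2 / e) *\<^sub>R (x - a)) \<longlongrightarrow> (2 / e) *\<^sub>R (a - a)) (at a)"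
      by (intro tendsto_scaleR_lcs tendsto_intros)
    then have 1: "\<forall>\<^sub>F x in at a. (2 / e) *\<^sub>R (x - a) \<in> U"
      using U by (auto simp: tendsto_def)
    have "((\<lambda>x. (2 / e) *\<^sub>R (a - x)) \<longlongrightarrow> (2 / e) *\<^sub>R (a - a)) (at a)"
      by (intro tendsto_scaleR_lcs tendsto_intros)
    then have 2: "\<forall>\<^sub>F x in at a. (2 / e) *\<^sub>R (a - x) \<in> U"
      using U by (auto simp: tendsto_def)
    from 1 2 show "\<forall>\<^sub>F x in at a. dist (\<phi> x) (\<phi> a) < e"
    proof eventually_elim
      case (elim x)
      have "(2 / e) * (\<phi> x - \<phi> a) \<le> 1" "(2 / e) * (\<phi> a - \<phi> x) \<le> 1"
        using le[OF elim(1)] le[OF elim(2)] by (simp_all add: linear_cmul[OF lin] linear_diff[OF lin])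
      then show ?case
        using e by (simp add: dist_real_def field_simps abs_if)
    qed
  qed
qed

theorem separating_functional:
  fixes S :: "'a::locally_convex_space set"
  assumes cvx: "convex S" and closed: "closed S" and ne: "S \<noteq> {}" and a: "a \<notin> S"
  obtains \<phi> c where "\<phi> \<in> topological_dual" "\<And>s. s \<in> S \<Longrightarrow> \<phi> s \<le> c" "c < \<phi> a"
proof -
  obtain s0 where s0: "s0 \<in> S"
    using ne by blast
  have "continuous_on UNIV (\<lambda>u. a - u)"
    by (intro continuous_intros)
  then have "open ((\<lambda>u. a - u) -` (- S))"
    using closed by (intro open_vimage) auto
  moreover have "0 \<in> (\<lambda>u. a - u) -` (- S)"
    using a by simp
  \<comment> \<open>The convex neighbourhood \<open>U\<close> of \<open>0\<close> is so small that
    \<open>a - U\<close> misses \<open>S\<close>.\<close>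
  ultimately obtain U where U: "open U" "0 \<in> U" and disj: "U \<subseteq> (\<lambda>u. a - u) -` (- S)"
    and cvxU: "convex U"
    by (rule convex_open_base_0_lcs)
  \<comment> \<open>\<open>K\<close> is \<open>(S - s0) + U\<close>: convex, absorbing because it
    contains \<open>U\<close>, and without the point \<open>a - s0\<close> because
    \<open>a - U\<close> misses \<open>S\<close>. Its gauge is therefore at most 1 on
    \<open>K\<close> and at least 1 at \<open>a - s0\<close>.\<close>
  define K where "K = (\<Union>x\<in>(\<lambda>s. s - s0) ` S. \<Union>u\<in>U. {x + u})"
  have "convex ((\<lambda>s. s - s0) ` S)"
    using convex_translation_subtract[OF cvx] .
  then have K: "convex K"
    unfolding K_def using cvxU by (rule convex_sums)
  have UK: "u \<in> K" if "u \<in> U" for u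
    using s0 that by (force simp: K_def)
  have absorbing: "\<exists>t>0. inverse t *\<^sub>R x \<in> K" for x
    using open_absorbing[OF U(1,2), of x] UK by blast
  have "a - s0 \<notin> K"
  proof
    assume "a - s0 \<in> K"
    then obtain s u where "s \<in> S" "u \<in> U" "a - s0 = (s - s0) + u"
      by (auto simp: K_def)
    then have "a - u = s"
      by (simp add: algebra_simps)
    then show False
      using disj \<open>s \<in> S\<close> \<open>u \<in> U\<close> by auto
  qed
  then have ge1: "1 \<le> minkowski_gauge K (a - s0)"
    by (rule minkowski_gauge_ge_1[OF K absorbing])
  obtain \<phi> where \<phi>: "linear \<phi>" "\<phi> \<le> minkowski_gauge K"
    "\<phi> (a - s0) = minkowski_gauge K (a - s0)"
    using Hahn_Banach_sublinear[OF sublinear_minkowski_gauge[OF K absorbing]] by blast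
  have le1: "\<phi> x \<le> 1" if "x \<in> K" for x
    using \<phi>(2) minkowski_gauge_le_1[OF K absorbing that]
    by (auto simp: le_fun_def intro: order_trans)
  have dual: "\<phi> \<in> topological_dual"
    using \<phi>(1) linear_continuous_bounded_above[OF \<phi>(1) U(1,2) le1] UK
    by (auto simp: topological_dual_def)
  obtain t where t: "0 < t" "inverse t *\<^sub>R (a - s0) \<in> U"
    using open_absorbing[OF U(1,2)] by blast
  \<comment> \<open>This \<open>u\<close> provides the strict gap: it lies in \<open>U\<close> and
    is a positive multiple of \<open>a - s0\<close>, where \<open>\<phi>\<close> is at least 1.
    Since \<open>(s - s0) + u\<close> is still in \<open>K\<close>, the values on \<open>S\<close>
    stay below \<open>\<phi> a\<close> by at least \<open>\<phi> u\<close>.\<close>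
  define u where "u = inverse t *\<^sub>R (a - s0)"
  have "0 < \<phi> u"
    using t ge1 \<phi>(3) by (simp add: u_def linear_cmul[OF \<phi>(1)])
  moreover have "\<phi> s \<le> \<phi> a - \<phi> u" if "s \<in> S" for s
  proof -
    have "(s - s0) + u \<in> K"
      using that t by (auto simp: K_def u_def)
    then have "\<phi> ((s - s0) + u) \<le> \<phi> (a - s0)"
      using le1[of "(s - s0) + u"] ge1 \<phi>(3) by linarith
    then show ?thesis
      by (simp add: linear_add[OF \<phi>(1)] linear_diff[OF \<phi>(1)])
  qed
  ultimately show thesis
    using that[OF dual, of "\<phi> a - \<phi> u"] by simp
qed

subsection \<open>The biconjugate as an intersection of halfspaces\<close>

lemma zero_topological_dual: "(\<lambda>_. 0) \<in> topological_dual"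
  by (auto simp: topological_dual_def intro!: linearI)

lemma topological_dual_add:
  "\<phi> \<in> topological_dual \<Longrightarrow> \<psi> \<in> topological_dual \<Longrightarrow> (\<lambda>x. \<phi> x + \<psi> x) \<in> topological_dual"
  by (auto simp: topological_dual_def intro!: linear_compose_add continuous_intros)

lemma topological_dual_scale:
  "\<phi> \<in> topological_dual \<Longrightarrow> (\<lambda>x. k * \<phi> x) \<in> topological_dual"
  using linear_compose_scale_right[of \<phi> k]
  by (auto simp: topological_dual_def intro!: continuous_intros)

text \<open>The second component is negated to match the form \<open>\<xi> x - \<zeta> z\<close> of
  the halfspaces that define the biconjugate.\<close>

lemma topological_dual_prodE:
  fixes \<phi> :: "'x::locally_convex_space \<times> 'z::locally_convex_space \<Rightarrow> real"
  assumes "\<phi> \<in> topological_dual"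
  obtains \<xi> \<zeta> where "\<xi> \<in> topological_dual" "\<zeta> \<in> topological_dual" "\<And>x z. \<phi> (x, z) = \<xi> x - \<zeta> z"
proof -
  have lin: "linear \<phi>" and cont: "continuous_on UNIV \<phi>"
    using assms by (auto simp: topological_dual_def)
  have "linear (\<lambda>x::'x. (x, 0::'z))" "linear (\<lambda>z::'z. (0::'x, - z))"
    by (intro linearI; simp)+
  from this[THEN linear_compose[OF _ lin]]
  have "linear (\<lambda>x. \<phi> (x, 0))" "linear (\<lambda>z. \<phi> (0, - z))"
    by (simp_all only: o_def)
  moreover have "continuous_on UNIV (\<lambda>x. \<phi> (x, 0))" "continuous_on UNIV (\<lambda>z. \<phi> (0, - z))"
    by (auto intro!: continuous_on_compose2[OF cont] continuous_intros)
  ultimately have dual: "(\<lambda>x. \<phi> (x, 0)) \<in> topological_dual" "(\<lambda>z. \<phi> (0, - z)) \<in> topological_dual"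
    by (auto simp: topological_dual_def)
  have "\<phi> (x, z) = \<phi> (x, 0) - \<phi> (0, - z)" for x z
    using linear_diff[OF lin, of "(x, 0)" "(0, - z)"] by simp
  with dual show thesis
    by (rule that)
qed

text \<open>This allows the value \<open>\<zeta> w\<close> at a point \<open>w\<close> of the
  conjugate to be replaced by an arbitrary real bound.\<close>

lemma linear_surj_real:
  fixes \<zeta> :: "'a::real_vector \<Rightarrow> real"
  assumes "linear \<zeta>" "\<zeta> \<noteq> (\<lambda>_. 0)"
  obtains w where "\<zeta> w = c"
proof -
  obtain v where "\<zeta> v \<noteq> 0"
    using assms(2) by auto
  then have "\<zeta> ((c / \<zeta> v) *\<^sub>R v) = c"
    by (simp add: linear_cmul[OF assms(1)])
  then show thesis by (rule that)
qed

lemma mem_conjugate: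
  assumes "linear \<zeta>"
  shows "w \<in> conjugate f \<xi> \<zeta> \<longleftrightarrow> (\<forall>y. \<forall>b\<in>f y. \<xi> y - \<zeta> b \<le> \<zeta> w)"
  by (auto simp: conjugate_def inf_residual_def S_fun_def linear_add[OF assms] image_subset_iff
      algebra_simps)

text \<open>Membership of \<open>w\<close> in the conjugate depends only on
  \<open>\<zeta> w\<close>, which takes every real value. Thus the biconjugate collects the points
  that lie in every nonvertical halfspace with \<open>\<zeta>\<close> in the dual cone containing
  the graph of \<open>f\<close>.\<close>

lemma mem_biconjugate:
  fixes f :: "'x::locally_convex_space \<Rightarrow> 'z::locally_convex_space set"
  shows "z \<in> biconjugate C f x \<longleftrightarrow>
    (\<forall>\<xi>\<in>topological_dual. \<forall>\<zeta>\<in>dual_cone C - {\<lambda>_. 0}. \<forall>c.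
      (\<forall>y. \<forall>b\<in>f y. \<xi> y - \<zeta> b \<le> c) \<longrightarrow> \<xi> x - \<zeta> z \<le> c)"
proof -
  have "z \<in> S_fun \<xi> \<zeta> x \<ominus>\<^sub>r conjugate f \<xi> \<zeta> \<longleftrightarrow>
      (\<forall>c. (\<forall>y. \<forall>b\<in>f y. \<xi> y - \<zeta> b \<le> c) \<longrightarrow> \<xi> x - \<zeta> z \<le> c)"
    if "\<zeta> \<in> dual_cone C - {\<lambda>_. 0}" for \<xi> \<zeta>
  proof -
    have lin: "linear \<zeta>"
      using that by (auto simp: dual_cone_def topological_dual_def)
    have "z \<in> S_fun \<xi> \<zeta> x \<ominus>\<^sub>r conjugate f \<xi> \<zeta> \<longleftrightarrow>
        (\<forall>w. (\<forall>y. \<forall>b\<in>f y. \<xi> y - \<zeta> b \<le> \<zeta> w) \<longrightarrow> \<xi> x - \<zeta> z \<le> \<zeta> w)"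
      by (auto simp: inf_residual_def S_fun_def mem_conjugate[OF lin] linear_add[OF lin]
          image_subset_iff diff_le_eq)
    also have "\<dots> \<longleftrightarrow> (\<forall>c. (\<forall>y. \<forall>b\<in>f y. \<xi> y - \<zeta> b \<le> c) \<longrightarrow> \<xi> x - \<zeta> z \<le> c)"
      using linear_surj_real[OF lin] that by (metis DiffD2 singletonI)
    finally show ?thesis .
  qed
  then show ?thesis
    by (auto simp: biconjugate_def)
qed

lemma le_biconjugate: "f x \<subseteq> biconjugate C f x"
  by (auto simp: mem_biconjugate)

text \<open>Each set on the right is a closed halfspace, so closedness and convexity of the
  biconjugate can be read off.\<close>

lemma graph_of_biconjugate:
  "graph_of (biconjugate C f) = (\<Inter>\<xi>\<in>topological_dual. \<Inter>\<zeta>\<in>dual_cone C - {\<lambda>_. 0}.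
     \<Inter>c\<in>{c. \<forall>y. \<forall>b\<in>f y. \<xi> y - \<zeta> b \<le> c}. {p. \<xi> (fst p) - \<zeta> (snd p) \<le> c})"
  by (auto simp: graph_of_def mem_biconjugate)

lemma closed_fun_biconjugate: "closed_fun (biconjugate C f)"
  unfolding closed_fun_def graph_of_biconjugate
proof (intro closed_INT ballI)
  fix \<xi> :: "'a \<Rightarrow> real" and \<zeta> :: "'b \<Rightarrow> real" and c :: real
  assume "\<xi> \<in> topological_dual" "\<zeta> \<in> dual_cone C - {\<lambda>_. 0}"
  then have "continuous_on UNIV \<xi>" "continuous_on UNIV \<zeta>"
    by (auto simp: dual_cone_def topological_dual_def)
  then have "continuous_on UNIV (\<lambda>p. \<xi> (fst p) - \<zeta> (snd p))"
    by (intro continuous_on_diff continuous_on_compose2[OF _ continuous_on_fst[OF continuous_on_id]]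
        continuous_on_compose2[OF _ continuous_on_snd[OF continuous_on_id]]) auto
  then show "closed {p. \<xi> (fst p) - \<zeta> (snd p) \<le> c}"
    by (intro closed_Collect_le) auto
qed

lemma convex_fun_biconjugate: "convex_fun (biconjugate C f)"
  unfolding convex_fun_def graph_of_biconjugate
proof (intro convex_INT)
  fix \<xi> :: "'a \<Rightarrow> real" and \<zeta> :: "'b \<Rightarrow> real" and c :: real
  assume "\<xi> \<in> topological_dual" "\<zeta> \<in> dual_cone C - {\<lambda>_. 0}"
  then have lin: "linear \<xi>" "linear \<zeta>"
    by (auto simp: dual_cone_def topological_dual_def)
  have "linear (\<lambda>p. \<xi> (fst p) - \<zeta> (snd p))"
    by (intro linearI)
      (auto simp: linear_add[OF lin(1)] linear_add[OF lin(2)] linear_cmul[OF lin(1)]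
        linear_cmul[OF lin(2)] algebra_simps)
  then have "convex ((\<lambda>p. \<xi> (fst p) - \<zeta> (snd p)) -` {..c})"
    by (intro convex_linear_vimage) auto
  then show "convex {p. \<xi> (fst p) - \<zeta> (snd p) \<le> c}"
    by (simp add: vimage_def)
qed

lemma biconjugate_eq_UNIV:
  assumes "f y = UNIV"
  shows "biconjugate C f x = UNIV"
proof -
  have "\<not> (\<forall>y. \<forall>b\<in>f y. \<xi> y - \<zeta> b \<le> c)" if "\<zeta> \<in> dual_cone C - {\<lambda>_. 0}" for \<xi> \<zeta> c
  proof -
    have "linear \<zeta>" "\<zeta> \<noteq> (\<lambda>_. 0)"
      using that by (auto simp: dual_cone_def topological_dual_def)
    \<comment> \<open>With this value, \<open>\<xi> y - \<zeta> w\<close> equals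
      \<open>c + 1\<close>, which refutes the bound \<open>c\<close>.\<close>
    then obtain w where "\<zeta> w = \<xi> y - c - 1"
      by (rule linear_surj_real)
    then have "w \<in> f y" "\<not> \<xi> y - \<zeta> w \<le> c"
      using assms by auto
    then show ?thesis by blast
  qed
  then have "z \<in> biconjugate C f x" for z
    unfolding mem_biconjugate by blast
  then show ?thesis by blast
qed

lemma biconjugate_empty:
  assumes "dual_cone C \<noteq> {\<lambda>_. 0}"
  shows "biconjugate C (\<lambda>_. {}) x = {}"
proof -
  have "(\<lambda>_. 0) \<in> dual_cone C"
    by (auto simp: dual_cone_def zero_topological_dual)
  then obtain \<zeta> where \<zeta>: "\<zeta> \<in> dual_cone C - {\<lambda>_. 0}"
    using assms by blast
  have "z \<notin> biconjugate C (\<lambda>_. {}) x" for z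
  proof
    assume "z \<in> biconjugate C (\<lambda>_. {}) x"
    \<comment> \<open>Over the empty graph every real \<open>c\<close> is an upper bound, so the
      pair of \<open>0\<close> and \<open>\<zeta>\<close> would force \<open>- \<zeta> z\<close>
      below all reals.\<close>
    from bspec[OF bspec[OF this[unfolded mem_biconjugate] zero_topological_dual] \<zeta>]
    have "- \<zeta> z \<le> c" for c
      by simp
    from this[of "- \<zeta> z - 1"] show False by simp
  qed
  then show ?thesis by blast
qed

section \<open>Separation from the graph of \<open>f\<close>, and the equivalence\<close>

lemma upper_sets_add:
  assumes "A \<in> upper_sets C" "a \<in> A" "c \<in> C"
  shows "a + c \<in> A"
proof -
  have "A = A + C"
    using assms(1) unfolding upper_sets_def by (rule CollectD)
  then have "A + C \<subseteq> A"
    by (rule equalityD2)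
  then show ?thesis
    using set_plus_intro[OF assms(2,3)] by (rule subsetD)
qed

text \<open>
  A functional that is bounded above on the graph is nonnegative on \<open>C\<close> in its second component,
  since the graph is invariant under translation by \<open>{0} \<times> C\<close>.
\<close>

lemma graph_separation:
  fixes f :: "'x::locally_convex_space \<Rightarrow> 'z::locally_convex_space set"
  assumes cone: "pos_cone C" and upper: "\<And>x. f x \<in> upper_sets C"
    and f: "closed_fun f" "convex_fun f" and ne: "f y \<noteq> {}" and z: "z \<notin> f x"
  obtains \<xi> \<zeta> c where "\<xi> \<in> topological_dual" "\<zeta> \<in> dual_cone C"
    "\<And>y b. b \<in> f y \<Longrightarrow> \<xi> y - \<zeta> b \<le> c" "c < \<xi> x - \<zeta> z"
proof -
  have "graph_of f \<noteq> {}" "(x, z) \<notin> graph_of f"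
    using ne z by (auto simp: graph_of_def)
  then obtain \<phi> c where \<phi>: "\<phi> \<in> topological_dual" "\<And>p. p \<in> graph_of f \<Longrightarrow> \<phi> p \<le> c" "c < \<phi> (x, z)"
    by (rule separating_functional[OF f(2)[unfolded convex_fun_def] f(1)[unfolded closed_fun_def]])
      blast
  obtain \<xi> \<zeta> where dual: "\<xi> \<in> topological_dual" "\<zeta> \<in> topological_dual"
    and \<phi>_eq: "\<And>x z. \<phi> (x, z) = \<xi> x - \<zeta> z"
    using topological_dual_prodE[OF \<phi>(1)] by blast
  have le: "\<xi> y - \<zeta> b \<le> c" if "b \<in> f y" for y b
    using \<phi>(2)[of "(y, b)"] that by (auto simp: graph_of_def \<phi>_eq)
  have lin: "linear \<zeta>"
    using dual by (auto simp: topological_dual_def)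
  have "0 \<le> \<zeta> v" if "v \<in> C" for v
  proof (rule ccontr)
    assume "\<not> 0 \<le> \<zeta> v"
    then have neg: "0 < - \<zeta> v" by simp
    obtain b where b: "b \<in> f y"
      using ne by blast
    \<comment> \<open>Moving from \<open>b\<close> by \<open>t v\<close> raises
      \<open>\<xi> y - \<zeta> b\<close> by the absolute value plus 1, hence above \<open>c\<close>;
      the absolute value keeps \<open>t\<close> positive.\<close>
    define t where "t = (\<bar>c - \<xi> y + \<zeta> b\<bar> + 1) / (- \<zeta> v)"
    have "0 < t"
      unfolding t_def using neg by (intro divide_pos_pos) auto
    then have "t *\<^sub>R v \<in> C"
      using cone that by (auto simp: pos_cone_def)
    then have "\<xi> y - \<zeta> (b + t *\<^sub>R v) \<le> c"
      by (intro le upper_sets_add[OF upper b])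
    moreover have "t * \<zeta> v = - (\<bar>c - \<xi> y + \<zeta> b\<bar> + 1)"
      using neg by (simp add: t_def)
    ultimately show False
      by (simp add: linear_add[OF lin] linear_cmul[OF lin])
  qed
  then have "\<zeta> \<in> dual_cone C"
    using dual(2) by (auto simp: dual_cone_def)
  show thesis
    by (rule that[OF dual(1) \<open>\<zeta> \<in> dual_cone C\<close>]) (use le \<phi>(3) in \<open>auto simp: \<phi>_eq\<close>)
qed

lemma biconjugate_eq_of_proper:
  fixes f :: "'x::locally_convex_space \<Rightarrow> 'z::locally_convex_space set"
  assumes cone: "pos_cone C" and upper: "\<And>x. f x \<in> upper_sets C"
    and f: "proper_fun f" "closed_fun f" "convex_fun f"
  shows "biconjugate C f x = f x"
proof (rule antisym)
  obtain y z1 where y: "f y \<noteq> {}" and z1: "z1 \<notin> f y"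
    using f(1) unfolding proper_fun_def by blast
  note separation = graph_separation[OF cone upper f(2,3) y]
  obtain \<xi>1 \<zeta>1 c1 where 1: "\<xi>1 \<in> topological_dual" "\<zeta>1 \<in> dual_cone C"
    "\<And>y b. b \<in> f y \<Longrightarrow> \<xi>1 y - \<zeta>1 b \<le> c1" "c1 < \<xi>1 y - \<zeta>1 z1"
    by (rule separation[OF z1]) blast
  obtain b1 where "b1 \<in> f y"
    using y by blast
  \<comment> \<open>Both points lie over the same \<open>y\<close>, so \<open>\<xi>1 y\<close>
    cancels and the separation shows that \<open>\<zeta>1\<close> is not constant.\<close>
  then have "\<zeta>1 z1 < \<zeta>1 b1"
    using 1(3)[of b1 y] 1(4) by simp
  then have \<zeta>1: "\<zeta>1 \<in> dual_cone C - {\<lambda>_. 0}"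
    using 1(2) by auto
  show "biconjugate C f x \<subseteq> f x"
  proof (rule subsetI, rule ccontr)
    fix z assume z: "z \<in> biconjugate C f x" "z \<notin> f x"
    obtain \<xi> \<zeta> c where 2: "\<xi> \<in> topological_dual" "\<zeta> \<in> dual_cone C"
      "\<And>y b. b \<in> f y \<Longrightarrow> \<xi> y - \<zeta> b \<le> c" "c < \<xi> x - \<zeta> z"
      by (rule separation[OF z(2)]) blast
    show False
    proof (cases "\<zeta> = (\<lambda>_. 0)")
      case False
      then show False
        using z(1)[unfolded mem_biconjugate, rule_format, of \<xi> \<zeta> c] 2 by auto
    next
      case True
      \<comment> \<open>The multiple is large enough for \<open>t * (\<xi> x - c)\<close> to exceed
        \<open>c1 - \<xi>1 x + \<zeta>1 z\<close>, so the combined functional separates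
        \<open>(x, z)\<close> from the graph.\<close>
      define t where "t = (\<bar>c1 - \<xi>1 x + \<zeta>1 z\<bar> + 1) / (\<xi> x - c)"
      have gap: "0 < \<xi> x - c"
        using 2(4) True by simp
      then have t: "0 < t" "t * (\<xi> x - c) = \<bar>c1 - \<xi>1 x + \<zeta>1 z\<bar> + 1"
        by (auto simp: t_def intro!: divide_pos_pos)
      \<comment> \<open>The vertical inequality, multiplied by \<open>t\<close>, is added to the
        nonvertical one; the second component remains \<open>\<zeta>1\<close>, hence
        admissible.\<close>
      have "(\<xi>1 v + t * \<xi> v) - \<zeta>1 b \<le> c1 + t * c" if "b \<in> f v" for v b
      proof -
        have "t * \<xi> v \<le> t * c"
          using 2(3)[OF that] t(1) True by (intro mult_left_mono) auto
        then show ?thesis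
          using 1(3)[OF that] by simp
      qed
      then have "(\<xi>1 x + t * \<xi> x) - \<zeta>1 z \<le> c1 + t * c"
        using z(1)[unfolded mem_biconjugate, rule_format,
            of "\<lambda>v. \<xi>1 v + t * \<xi> v" \<zeta>1 "c1 + t * c"] \<zeta>1
          topological_dual_add[OF 1(1) topological_dual_scale[OF 2(1), of t]]
        by simp
      then show False
        using t(2) by (simp add: right_diff_distrib)
    qed
  qed
qed (rule le_biconjugate)

theorem theorem5p8:
  fixes f :: "'x::locally_convex_space \<Rightarrow> 'z::locally_convex_space set"
    and C :: "'z set"
  assumes "(UNIV :: 'x set) \<noteq> {0}" and "(UNIV :: 'z set) \<noteq> {0}"
    and "pos_cone C" and "convex C" and "0 \<in> C" and "C \<noteq> UNIV"
    and "\<And>x. f x \<in> upper_sets C"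
    and "f = (\<lambda>x. {}) \<Longrightarrow> dual_cone C \<noteq> {\<lambda>z. 0}"
  shows "f = biconjugate C f \<longleftrightarrow>
    (proper_fun f \<and> closed_fun f \<and> convex_fun f) \<or> f = (\<lambda>x. UNIV) \<or> f = (\<lambda>x. {})"
proof
  assume eq: "f = biconjugate C f"
  have "closed_fun f" "convex_fun f"
    using closed_fun_biconjugate[of C f] convex_fun_biconjugate[of C f] eq by simp_all
  \<comment> \<open>A single value \<open>UNIV\<close> spreads to all points, so a function that is
    neither identically \<open>UNIV\<close> nor identically empty must be proper.\<close>
  moreover have "f = (\<lambda>x. UNIV)" if "f y = UNIV" for y
    using biconjugate_eq_UNIV[of f y C, OF that] eq by auto
  ultimately show "(proper_fun f \<and> closed_fun f \<and> convex_fun f) \<or> f = (\<lambda>x. UNIV) \<or> f = (\<lambda>x. {})"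
    unfolding proper_fun_def by blast
next
  assume "(proper_fun f \<and> closed_fun f \<and> convex_fun f) \<or> f = (\<lambda>x. UNIV) \<or> f = (\<lambda>x. {})"
  then consider "proper_fun f \<and> closed_fun f \<and> convex_fun f" | "f = (\<lambda>x. UNIV)" | "f = (\<lambda>x. {})"
    by blast
  then show "f = biconjugate C f"
  proof cases
    case 1
    then show ?thesis
      by (intro ext biconjugate_eq_of_proper[OF assms(3,7), symmetric]) auto
  next
    case 2
    then show ?thesis
      using biconjugate_eq_UNIV[of f _ C] by auto
  next
    case 3
    then show ?thesis
      using biconjugate_empty[OF assms(8)] by auto
  qed
qed

end
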